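(* Let $\mathcal{M}$ and $\mathcal{M}'$ be Kripke models, let $w$ be a state of $\mathcal{M}$ and $w'$ a state of $\mathcal{M}'$. Then $$(\mathcal{M},w)\equiv_{\mathcal{L}(\nabla)}(\mathcal{M}',w')\iff (ue(\mathcal{M}),\pi_w)\mathrel{\underline{\leftrightarrow}}_\Delta(ue(\mathcal{M}'),\pi_{w'}),$$ where $ue(\cdot)$ is the ($\exists\forall$-version) ultrafilter extension for contingency logic, $\equiv_{\mathcal{L}(\nabla)}$ is $\mathcal{L}(\nabla)$-equivalence and $\underline{\leftrightarrow}_\Delta$ is $\Delta$-bisimilarity.
   Context: A Kripke model is $\mathcal{M}=\langle S,R,V\rangle$ with $S\neq\emptyset$, $R\subseteq S\times S$, $V:\mathbf{P}\to\mathcal{P}(S)$, where $\mathbf{P}$ is the set of propositional variables. $\mathcal{L}(\nabla)$ is the propositional language with $\neg,\wedge$ and a unary operator $\nabla$ (contingency); $\Delta\phi$ abbreviates $\neg\nabla\phi$. Semantics: $\mathcal{M},s\vDash\nabla\phi$ iff there are $t,u\in S$ with $Rst$, $Rsu$, $\mathcal{M},t\vDash\phi$ and $\mathcal{M},u\nvDash\phi$; Booleans as usual. $(\mathcal{M},w)\equiv_{\mathcal{L}(\nabla)}(\mathcal{M}',w')$ means that the two pointed models satisfy the same $\mathcal{L}(\nabla)$-formulas. For $X\subseteq S$, $\overline{X}=S\setminus X$ and $m_\nabla(X)=\{s\in S\mid Rst,Rsu\text{ for some }t\in X\text{ and some }u\notin X\}$, $m_\Delta(X)=\{s\in S\mid\text{for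 all }t,u,\text{ if }Rst\text{ and }Rsu,\text{ then }(t\in X\text{ iff }u\in X)\}$. Ultrafilter extension ($\exists\forall$-version): $ue(\mathcal{M})=\langle Uf(S),R^{ue},V^{ue}\rangle$, where $Uf(S)$ is the set of all ultrafilters over $S$; $R^{ue}st$ iff there exists $X\subseteq S$ such that $m_\nabla(X)\in s$ and, for all $Y\subseteq S$, if $m_\Delta(Y)\cap m_\Delta(\overline{X}\cup Y)\in s$, then $Y\in t$; and $V^{ue}(p)=\{s\in Uf(S)\mid V(p)\in s\}$. For $w\in S$, $\pi_w=\{X\subseteq S\mid w\in X\}$. $\Delta$-bisimulation: a nonempty binary relation $Z$ on the domain of a Kripke model is a $\Delta$-bisimulation on that model if whenever $sZs'$: (Inv) $s$ and $s'$ satisfy the same propositional variables; ($\Delta$-Zig) if there are two different successors $t_1,t_2$ of $s$ with $(t_1,t_2)\notin Z$, and $Rst$, then there is $t'$ with $Rs't'$ and $tZt'$; ($\Delta$-Zag) if there are two different successors $t_1',t_2'$ of $s'$ with $(t_1',t_2')\notin Z$, and $Rs't'$, then there is $t$ with $Rst$ and $tZt'$. $(\mathcal{N},s)\mathrel{\underline{\leftrightarrow}}_\Delta(\mathcal{N}',s')$ means that there is a $\Delta$-bisimulation $Z$ on the disjoint union of $\mathcal{N}$ and $\mathcal{N}'$ with $sZs'$. *)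

theory Defs
  imports Main
begin

record ('a, 'p) kripke =
  states :: "'a set"
  acc :: "('a \<times> 'a) set"
  val :: "'p \<Rightarrow> 'a set"

definition kripke_model :: "('a, 'p) kripke \<Rightarrow> bool" where
  "kripke_model M \<longleftrightarrow>
     states M \<noteq> {} \<and> acc M \<subseteq> states M \<times> states M \<and> (\<forall>p. val M p \<subseteq> states M)"

datatype 'p fm =
    Var 'p
  | Neg "'p fm"
  | Conj "'p fm" "'p fm"
  | Nabla "'p fm"

abbreviation Delta :: "'p fm \<Rightarrow> 'p fm" where
  "Delta \<phi> \<equiv> Neg (Nabla \<phi>)"

primrec sat :: "('a, 'p) kripke \<Rightarrow> 'a \<Rightarrow> 'p fm \<Rightarrow> bool" where
  "sat M s (Var p) \<longleftrightarrow> s \<in> val M p"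
| "sat M s (Neg \<phi>) \<longleftrightarrow> \<not> sat M s \<phi>"
| "sat M s (Conj \<phi> \<psi>) \<longleftrightarrow> sat M s \<phi> \<and> sat M s \<psi>"
| "sat M s (Nabla \<phi>) \<longleftrightarrow>
     (\<exists>t\<in>states M. \<exists>u\<in>states M. (s, t) \<in> acc M \<and> (s, u) \<in> acc M \<and> sat M t \<phi> \<and> \<not> sat M u \<phi>)"

definition nabla_equiv :: "('a, 'p) kripke \<Rightarrow> 'a \<Rightarrow> ('b, 'p) kripke \<Rightarrow> 'b \<Rightarrow> bool" where
  "nabla_equiv M w M' w' \<longleftrightarrow> (\<forall>\<phi>. sat M w \<phi> \<longleftrightarrow> sat M' w' \<phi>)"

definition m_nabla :: "('a, 'p) kripke \<Rightarrow> 'a set \<Rightarrow> 'a set" where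
  "m_nabla M X = {s \<in> states M. \<exists>t u. t \<in> X \<and> u \<notin> X \<and> (s, t) \<in> acc M \<and> (s, u) \<in> acc M}"

definition m_delta :: "('a, 'p) kripke \<Rightarrow> 'a set \<Rightarrow> 'a set" where
  "m_delta M X =
     {s \<in> states M. \<forall>t u. (s, t) \<in> acc M \<and> (s, u) \<in> acc M \<longrightarrow> (t \<in> X \<longleftrightarrow> u \<in> X)}"

definition ultrafilter_over :: "'a set \<Rightarrow> 'a set set \<Rightarrow> bool" where
  "ultrafilter_over S U \<longleftrightarrow>
     U \<subseteq> Pow S \<and> S \<in> U \<and> {} \<notin> U \<and>
     (\<forall>X Y. X \<in> U \<and> Y \<in> U \<longrightarrow> X \<inter> Y \<in> U) \<and>
     (\<forall>X Y. X \<in> U \<and> X \<subseteq> Y \<and> Y \<subseteq> S \<longrightarrow> Y \<in> U) \<and>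
     (\<forall>X. X \<subseteq> S \<longrightarrow> (X \<in> U \<longleftrightarrow> S - X \<notin> U))"

definition Uf :: "'a set \<Rightarrow> 'a set set set" where
  "Uf S = {U. ultrafilter_over S U}"

definition principal_ultrafilter :: "'a set \<Rightarrow> 'a \<Rightarrow> 'a set set" where
  "principal_ultrafilter S w = {X. X \<subseteq> S \<and> w \<in> X}"

definition ue :: "('a, 'p) kripke \<Rightarrow> ('a set set, 'p) kripke" where
  "ue M = \<lparr>
     states = Uf (states M),
     acc = {(s, t). s \<in> Uf (states M) \<and> t \<in> Uf (states M) \<and>
       (\<exists>X \<subseteq> states M. m_nabla M X \<in> s \<and>
         (\<forall>Y \<subseteq> states M. m_delta M Y \<inter> m_delta M ((states M - X) \<union> Y) \<in> s \<longrightarrow> Y \<in> t))},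
     val = (\<lambda>p. {s \<in> Uf (states M). val M p \<in> s})\<rparr>"

lemma principal_ultrafilter_in_Uf: "w \<in> S \<Longrightarrow> principal_ultrafilter S w \<in> Uf S"
  by (auto simp: Uf_def ultrafilter_over_def principal_ultrafilter_def)

lemma kripke_model_ue: "kripke_model M \<Longrightarrow> kripke_model (ue M)"
  using principal_ultrafilter_in_Uf by (fastforce simp: kripke_model_def ue_def)

definition delta_bisimulation :: "('a, 'p) kripke \<Rightarrow> ('a \<times> 'a) set \<Rightarrow> bool" where
  "delta_bisimulation M Z \<longleftrightarrow>
     Z \<noteq> {} \<and> Z \<subseteq> states M \<times> states M \<and>
     (\<forall>(s, s') \<in> Z.
        (\<forall>p. s \<in> val M p \<longleftrightarrow> s' \<in> val M p) \<and>
        ((\<exists>t1 t2. t1 \<noteq> t2 \<and> (s, t1) \<in> acc M \<and> (s, t2) \<in> acc M \<and> (t1, t2) \<notin> Z) \<longrightarrow>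
           (\<forall>t. (s, t) \<in> acc M \<longrightarrow> (\<exists>t'. (s', t') \<in> acc M \<and> (t, t') \<in> Z))) \<and>
        ((\<exists>t1' t2'. t1' \<noteq> t2' \<and> (s', t1') \<in> acc M \<and> (s', t2') \<in> acc M \<and> (t1', t2') \<notin> Z) \<longrightarrow>
           (\<forall>t'. (s', t') \<in> acc M \<longrightarrow> (\<exists>t. (s, t) \<in> acc M \<and> (t, t') \<in> Z))))"

definition disjoint_union ::
    "('a, 'p) kripke \<Rightarrow> ('b, 'p) kripke \<Rightarrow> ('a + 'b, 'p) kripke" where
  "disjoint_union M M' = \<lparr>
     states = states M <+> states M',
     acc = {(Inl s, Inl t) | s t. (s, t) \<in> acc M} \<union> {(Inr s, Inr t) | s t. (s, t) \<in> acc M'},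
     val = (\<lambda>p. val M p <+> val M' p)\<rparr>"

definition delta_bisimilar ::
    "('a, 'p) kripke \<Rightarrow> 'a \<Rightarrow> ('b, 'p) kripke \<Rightarrow> 'b \<Rightarrow> bool" where
  "delta_bisimilar N s N' s' \<longleftrightarrow>
     (\<exists>Z. delta_bisimulation (disjoint_union N N') Z \<and> (Inl s, Inr s') \<in> Z)"

end

theory Submission imports Defs begin

text \<open>
  The proof rests on the observation that the accessibility relation of \<^term>\<open>ue M\<close> is the
  classical one in disguise. At a state where \<^term>\<open>X\<close> is contingent, \<^term>\<open>Y\<close> is necessary exactly
  when \<^term>\<open>Y\<close> and \<open>X \<longrightarrow> Y\<close> are both non-contingent: if \<^term>\<open>Y\<close> failed at all successors,
  \<open>X \<longrightarrow> Y\<close> would be equivalent to \<open>\<not> X\<close> there, hence contingent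
  (\<open>necessity_definable_from_contingency\<close>). So an ultrafilter \<^term>\<open>s\<close> sees \<^term>\<open>t\<close> in
  \<^term>\<open>ue M\<close> iff \<^term>\<open>s\<close> contains some contingency and \<^term>\<open>t\<close> contains every set that is
  necessary according to \<^term>\<open>s\<close> (\<open>acc_ue_iff\<close>).

  From there the usual modal argument goes through. The ultrafilter theorem provides enough
  successors in \<^term>\<open>ue M\<close> (\<open>ue_saturated\<close>), which gives the truth lemma \<open>sat_ue_iff\<close>: a formula
  holds at an ultrafilter iff its truth set belongs to it. In particular \<^term>\<open>w\<close> and the principal
  ultrafilter at \<^term>\<open>w\<close> satisfy the same formulas, so the theorem is about ultrafilter extensions
  only. One direction is then the invariance of formulas under \<open>\<Delta>\<close>-bisimulations. For the other,
  modal equivalence on the disjoint union is itself a \<open>\<Delta>\<close>-bisimulation: two inequivalent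
  successors of \<^term>\<open>s\<close> yield a formula that is contingent at \<^term>\<open>s\<close>, so necessity becomes
  expressible at \<^term>\<open>s\<close> and at every equivalent state, and saturation supplies the matching
  successors (\<open>ue_forth\<close>).
\<close>

section \<open>Ultrafilters\<close>

lemma ultrafilterD:
  assumes "U \<in> Uf S"
  shows "X \<in> U \<Longrightarrow> X \<subseteq> S" and "S \<in> U" and "{} \<notin> U"
    and "X \<in> U \<Longrightarrow> Y \<in> U \<Longrightarrow> X \<inter> Y \<in> U"
    and "X \<in> U \<Longrightarrow> X \<subseteq> Y \<Longrightarrow> Y \<subseteq> S \<Longrightarrow> Y \<in> U"
    and "X \<subseteq> S \<Longrightarrow> S - X \<in> U \<longleftrightarrow> X \<notin> U"
proof -
  have "U \<subseteq> Pow S" and rest: "S \<in> U" "{} \<notin> U"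
    "\<forall>X Y. X \<in> U \<and> Y \<in> U \<longrightarrow> X \<inter> Y \<in> U"
    "\<forall>X Y. X \<in> U \<and> X \<subseteq> Y \<and> Y \<subseteq> S \<longrightarrow> Y \<in> U"
    "\<forall>X. X \<subseteq> S \<longrightarrow> (X \<in> U \<longleftrightarrow> S - X \<notin> U)"
    using assms unfolding Uf_def ultrafilter_over_def mem_Collect_eq by iprover+
  then show "X \<in> U \<Longrightarrow> X \<subseteq> S" by blast
  show "S \<in> U" "{} \<notin> U"
    by (fact rest)+
  show "X \<in> U \<Longrightarrow> Y \<in> U \<Longrightarrow> X \<inter> Y \<in> U"
    by (rule rest(3)[THEN spec, THEN spec, THEN mp, OF conjI])
  show "X \<in> U \<Longrightarrow> X \<subseteq> Y \<Longrightarrow> Y \<subseteq> S \<Longrightarrow> Y \<in> U"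
    by (rule rest(4)[THEN spec, THEN spec, THEN mp, OF conjI[OF _ conjI]])
  show "X \<subseteq> S \<Longrightarrow> S - X \<in> U \<longleftrightarrow> X \<notin> U"
    using rest(5)[THEN spec, of X] by simp
qed

lemma ultrafilter_Int_iff:
  assumes "U \<in> Uf S" and "X \<subseteq> S" and "Y \<subseteq> S"
  shows "X \<inter> Y \<in> U \<longleftrightarrow> X \<in> U \<and> Y \<in> U"
  using ultrafilterD(4,5)[OF assms(1)] assms(2,3) by (meson Int_lower1 Int_lower2)

lemma ultrafilter_Un:
  assumes "U \<in> Uf S" and "X \<union> Y \<in> U"
  shows "X \<in> U \<or> Y \<in> U"
proof (rule ccontr)
  assume neither: "\<not> (X \<in> U \<or> Y \<in> U)"
  have "X \<subseteq> S" "Y \<subseteq> S"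
    using ultrafilterD(1)[OF assms] by auto
  then have "S - X \<in> U" "S - Y \<in> U"
    using ultrafilterD(6)[OF assms(1)] neither by auto
  then have "(S - X) \<inter> (S - Y) \<inter> (X \<union> Y) \<in> U"
    using ultrafilterD(4)[OF assms(1)] assms(2) by blast
  moreover have "(S - X) \<inter> (S - Y) \<inter> (X \<union> Y) = {}" by blast
  ultimately show False
    using ultrafilterD(3)[OF assms(1)] by simp
qed

text \<open>
  The ultrafilter theorem. By Zorn's lemma there is a maximal proper extension \<open>U\<close> of the base that
  is closed under intersection. Maximality forces \<open>U\<close> to contain every set that meets all its
  members, since the traces of such a set on \<open>U\<close> could be added; all ultrafilter properties follow
  from this.
\<close>

lemma ultrafilter_extending_filter_base:
  assumes sub: "B \<subseteq> Pow S" and ne: "B \<noteq> {}" and proper: "{} \<notin> B"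
    and Int: "\<And>X Y. X \<in> B \<Longrightarrow> Y \<in> B \<Longrightarrow> X \<inter> Y \<in> B"
  shows "\<exists>U\<in>Uf S. B \<subseteq> U"
proof -
  define \<F> where
    "\<F> = {F. F \<subseteq> Pow S \<and> {} \<notin> F \<and> (\<forall>X\<in>F. \<forall>Y\<in>F. X \<inter> Y \<in> F) \<and> B \<subseteq> F}"
  have \<F>I: "F \<in> \<F>"
    if "F \<subseteq> Pow S" "{} \<notin> F" "\<And>X Y. X \<in> F \<Longrightarrow> Y \<in> F \<Longrightarrow> X \<inter> Y \<in> F" "B \<subseteq> F" for F
    using that unfolding \<F>_def mem_Collect_eq by (intro conjI ballI)
  have \<F>D: "F \<subseteq> Pow S" "{} \<notin> F" "B \<subseteq> F" if "F \<in> \<F>" for F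
    using that unfolding \<F>_def by simp_all
  have \<F>_Int: "X \<inter> Y \<in> F" if "F \<in> \<F>" "X \<in> F" "Y \<in> F" for F X Y
    using that unfolding \<F>_def by simp
  have "B \<in> \<F>"
    using sub proper Int by (intro \<F>I) auto
  then have "\<F> \<noteq> {}" by blast
  moreover have "\<Union>C \<in> \<F>" if "C \<noteq> {}" "subset.chain \<F> C" for C
  proof -
    have C: "F \<in> \<F>" if "F \<in> C" for F
      using \<open>subset.chain \<F> C\<close> that by (auto simp: subset_chain_def)
    show ?thesis
    proof (rule \<F>I)
      fix X Y assume "X \<in> \<Union>C" "Y \<in> \<Union>C"
      then obtain F G where FG: "F \<in> C" "G \<in> C" "X \<in> F" "Y \<in> G" by auto
      then have "F \<subseteq> G \<or> G \<subseteq> F"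
        using \<open>subset.chain \<F> C\<close> by (simp add: subset_chain_def)
      then show "X \<inter> Y \<in> \<Union>C"
      proof
        assume "F \<subseteq> G"
        then have "X \<inter> Y \<in> G" using FG \<F>_Int[OF C] by (simp add: subset_iff)
        then show ?thesis using FG(2) by (rule UnionI[rotated])
      next
        assume "G \<subseteq> F"
        then have "X \<inter> Y \<in> F" using FG \<F>_Int[OF C] by (simp add: subset_iff)
        then show ?thesis using FG(1) by (rule UnionI[rotated])
      qed
    next
      show "\<Union>C \<subseteq> Pow S" using \<F>D(1)[OF C] by (rule Union_least)
      show "{} \<notin> \<Union>C" using \<F>D(2)[OF C] by auto
      obtain F where "F \<in> C" using \<open>C \<noteq> {}\<close> by auto
      then show "B \<subseteq> \<Union>C" using \<F>D(3)[OF C] by (meson Union_upper order_trans)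
    qed
  qed
  ultimately have "\<exists>U\<in>\<F>. \<forall>F\<in>\<F>. U \<subseteq> F \<longrightarrow> F = U"
    by (rule subset_Zorn_nonempty)
  then obtain U where U: "U \<in> \<F>" and max: "\<And>F. F \<in> \<F> \<Longrightarrow> U \<subseteq> F \<Longrightarrow> F = U"
    by (auto simp only:)
  note UD = \<F>D(1,2)[OF U] \<F>_Int[OF U] \<F>D(3)[OF U]
  have mem_if_meets: "X \<in> U" if "X \<subseteq> S" and meets: "\<And>Y. Y \<in> U \<Longrightarrow> X \<inter> Y \<noteq> {}" for X
  proof -
    let ?F = "insert X (U \<union> (\<lambda>Y. X \<inter> Y) ` U)"
    have "P \<inter> Q \<in> ?F" if PQ: "P \<in> ?F" "Q \<in> ?F" for P Q
    proof -
      have form: "P = X \<or> P \<in> U \<or> (\<exists>Y\<in>U. P = X \<inter> Y)" "Q = X \<or> Q \<in> U \<or> (\<exists>Y\<in>U. Q = X \<inter> Y)"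
        using PQ by auto
      have trace: "X \<inter> Y \<in> ?F" "Y \<inter> X \<in> ?F" if "Y \<in> U" for Y
        using that by (auto simp: Int_commute)
      have traces: "X \<inter> Y \<inter> Z \<in> ?F" "Y \<inter> (X \<inter> Z) \<in> ?F" if "Y \<in> U" "Z \<in> U" for Y Z
        using trace(1)[OF UD(3)[OF that]] by (simp_all add: Int_ac)
      show ?thesis
        using form
      proof (elim disjE bexE)
        fix Y Z assume "P = X \<inter> Y" "Y \<in> U" "Q = X \<inter> Z" "Z \<in> U"
        then show ?thesis using traces(1)[of Y Z] by (simp add: Int_ac)
      qed (use trace traces UD(3) in \<open>simp_all add: Int_ac\<close>)
    qed
    moreover have "X \<noteq> {}"
      using ne UD(4) meets by blast
    then have "{} \<notin> ?F"
      using UD(2) meets by (metis UnE imageE insertE)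
    moreover have "?F \<subseteq> Pow S" "B \<subseteq> ?F"
      using UD(1,4) \<open>X \<subseteq> S\<close> by auto
    ultimately have "?F \<in> \<F>"
      by (intro \<F>I)
    then have "?F = U"
      by (rule max) blast
    then show ?thesis by blast
  qed
  have S: "S \<in> U"
    using UD(1,2) by (intro mem_if_meets) (auto simp: Int_absorb1)
  have up: "Y \<in> U" if "X \<in> U" "X \<subseteq> Y" "Y \<subseteq> S" for X Y
  proof (rule mem_if_meets)
    show "Y \<inter> Z \<noteq> {}" if "Z \<in> U" for Z
      using UD(3)[OF \<open>X \<in> U\<close> \<open>Z \<in> U\<close>] UD(2) \<open>X \<subseteq> Y\<close> by (metis Int_mono order_refl subset_empty)
  qed fact
  have compl: "X \<in> U \<longleftrightarrow> S - X \<notin> U" if "X \<subseteq> S" for X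
  proof
    assume "X \<in> U"
    show "S - X \<notin> U"
    proof
      assume "S - X \<in> U"
      with UD(3)[OF \<open>X \<in> U\<close>] have "X \<inter> (S - X) \<in> U" .
      then show False using UD(2) by simp
    qed
  next
    assume "S - X \<notin> U"
    then obtain Z where Z: "Z \<in> U" "(S - X) \<inter> Z = {}"
      using mem_if_meets[of "S - X"] by blast
    then have "Z \<subseteq> X" using UD(1) by blast
    with Z(1) show "X \<in> U" using up \<open>X \<subseteq> S\<close> by blast
  qed
  have "U \<in> Uf S"
    unfolding Uf_def ultrafilter_over_def mem_Collect_eq
    using UD(1-3) S up compl by (intro conjI allI impI) (assumption | elim conjE | rule up)+
  with UD(4) show ?thesis by blast
qed

section \<open>Necessity and the ultrafilter extension\<close>

definition m_box :: "('a, 'p) kripke \<Rightarrow> 'a set \<Rightarrow> 'a set" where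
  "m_box M X = {s \<in> states M. \<forall>t. (s, t) \<in> acc M \<longrightarrow> t \<in> X}"

lemma m_subset_states:
  "m_nabla M X \<subseteq> states M" "m_delta M X \<subseteq> states M" "m_box M X \<subseteq> states M"
  by (auto simp: m_nabla_def m_delta_def m_box_def)

lemma m_deltaD: "s \<in> m_delta M X \<Longrightarrow> (s, t) \<in> acc M \<Longrightarrow> (s, u) \<in> acc M \<Longrightarrow> t \<in> X \<Longrightarrow> u \<in> X"
  unfolding m_delta_def by blast

lemma m_box_subset_m_delta: "m_box M X \<subseteq> m_delta M X"
  unfolding m_box_def m_delta_def by blast

lemma m_box_Int: "m_box M X \<inter> m_box M Y = m_box M (X \<inter> Y)"
  by (auto simp: m_box_def)

lemma m_box_mono: "X \<subseteq> Y \<Longrightarrow> m_box M X \<subseteq> m_box M Y"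
  by (auto simp: m_box_def)

lemma kripke_accD:
  assumes "kripke_model M" and "(s, t) \<in> acc M"
  shows "s \<in> states M" and "t \<in> states M"
  using assms by (auto simp: kripke_model_def)

lemma states_diff_m_nabla:
  assumes "kripke_model M"
  shows "states M - m_nabla M X = m_box M X \<union> m_box M (states M - X)"
  using kripke_accD[OF assms] unfolding m_nabla_def m_box_def by blast

text \<open>
  At a state with a successor inside and a successor outside \<^term>\<open>X\<close>, suppose \<^term>\<open>Y\<close> and
  \<open>X \<longrightarrow> Y\<close> are non-contingent. The successor outside \<^term>\<open>X\<close> satisfies \<open>X \<longrightarrow> Y\<close>, so the
  one inside does as well and thus lies in \<^term>\<open>Y\<close>; then all successors do.
\<close>

lemma necessity_definable_from_contingency:
  assumes "kripke_model M"
  shows "m_nabla M X \<inter> (m_delta M Y \<inter> m_delta M ((states M - X) \<union> Y)) = m_nabla M X \<inter> m_box M Y"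
proof (intro subset_antisym subsetI)
  fix s assume s: "s \<in> m_nabla M X \<inter> (m_delta M Y \<inter> m_delta M ((states M - X) \<union> Y))"
  then obtain t u where tu: "(s, t) \<in> acc M" "(s, u) \<in> acc M" "t \<in> X" "u \<notin> X"
    by (auto simp: m_nabla_def)
  have "u \<in> (states M - X) \<union> Y"
    using tu kripke_accD(2)[OF assms tu(2)] by simp
  then have "t \<in> (states M - X) \<union> Y"
    by (intro m_deltaD[of s M _ u t]) (use s tu(1,2) in simp_all)
  then have "t \<in> Y"
    using tu(3) by simp
  then have "v \<in> Y" if "(s, v) \<in> acc M" for v
    by (intro m_deltaD[of s M Y t v]) (use s tu(1) that in simp_all)
  then show "s \<in> m_nabla M X \<inter> m_box M Y"
    using s by (simp add: m_nabla_def m_box_def)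
next
  fix s assume "s \<in> m_nabla M X \<inter> m_box M Y"
  moreover have "m_box M Y \<subseteq> m_delta M Y" "m_box M Y \<subseteq> m_delta M ((states M - X) \<union> Y)"
    using m_box_subset_m_delta m_box_mono[of Y "(states M - X) \<union> Y" M] by (meson Un_upper2 order_trans)+
  ultimately show "s \<in> m_nabla M X \<inter> (m_delta M Y \<inter> m_delta M ((states M - X) \<union> Y))"
    by (simp add: subset_iff)
qed

lemma acc_ue_iff:
  assumes "kripke_model M"
  shows "(s, t) \<in> acc (ue M) \<longleftrightarrow> s \<in> Uf (states M) \<and> t \<in> Uf (states M) \<and>
    (\<exists>X\<subseteq>states M. m_nabla M X \<in> s) \<and> (\<forall>Y\<subseteq>states M. m_box M Y \<in> s \<longrightarrow> Y \<in> t)"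
proof -
  have "m_delta M Y \<inter> m_delta M ((states M - X) \<union> Y) \<in> s \<longleftrightarrow> m_box M Y \<in> s"
    if s: "s \<in> Uf (states M)" and X: "m_nabla M X \<in> s" for X Y
  proof -
    have "m_delta M Y \<inter> m_delta M ((states M - X) \<union> Y) \<in> s \<longleftrightarrow>
        m_nabla M X \<inter> (m_delta M Y \<inter> m_delta M ((states M - X) \<union> Y)) \<in> s"
      using X by (simp add: ultrafilter_Int_iff[OF s] m_subset_states le_infI1)
    also have "\<dots> \<longleftrightarrow> m_box M Y \<in> s"
      unfolding necessity_definable_from_contingency[OF assms]
      using X by (simp add: ultrafilter_Int_iff[OF s] m_subset_states)
    finally show ?thesis .
  qed
  then have "(\<exists>X\<subseteq>states M. m_nabla M X \<in> s \<and> (\<forall>Y\<subseteq>states M.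
        m_delta M Y \<inter> m_delta M ((states M - X) \<union> Y) \<in> s \<longrightarrow> Y \<in> t)) \<longleftrightarrow>
      (\<exists>X\<subseteq>states M. m_nabla M X \<in> s) \<and> (\<forall>Y\<subseteq>states M. m_box M Y \<in> s \<longrightarrow> Y \<in> t)"
    if "s \<in> Uf (states M)"
    using that by (simp cong: conj_cong) iprover
  then show ?thesis
    by (simp add: ue_def cong: conj_cong)
qed

lemma acc_ueD:
  assumes "kripke_model M" and "(s, t) \<in> acc (ue M)"
  shows "s \<in> Uf (states M)" and "t \<in> Uf (states M)"
    and "Y \<subseteq> states M \<Longrightarrow> m_box M Y \<in> s \<Longrightarrow> Y \<in> t"
  using assms(2) by (simp_all add: acc_ue_iff[OF assms(1)])

text \<open>
  If \<^term>\<open>Y\<close> is necessary according to \<^term>\<open>s\<close> and \<^term>\<open>Z\<close> is in \<^term>\<open>A\<close>, then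
  \<^term>\<open>Y \<inter> Z\<close> is nonempty, as otherwise \<^term>\<open>Y\<close> would lie in the complement of \<^term>\<open>Z\<close>, making that complement
  necessary. Hence
  these intersections form a filter base, and any ultrafilter extending it is a successor of
  \<^term>\<open>s\<close>.
\<close>

lemma ue_saturated:
  assumes M: "kripke_model M" and s: "s \<in> Uf (states M)"
    and X: "X \<subseteq> states M" "m_nabla M X \<in> s"
    and A: "A \<subseteq> Pow (states M)" "A \<noteq> {}" "\<And>Y Z. Y \<in> A \<Longrightarrow> Z \<in> A \<Longrightarrow> Y \<inter> Z \<in> A"
    and possible: "\<And>Z. Z \<in> A \<Longrightarrow> m_box M (states M - Z) \<notin> s"
  shows "\<exists>t. (s, t) \<in> acc (ue M) \<and> A \<subseteq> t"
proof -
  define B where "B = {Y \<inter> Z | Y Z. Y \<subseteq> states M \<and> m_box M Y \<in> s \<and> Z \<in> A}"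
  have BI: "Y \<inter> Z \<in> B" if "Y \<subseteq> states M" "m_box M Y \<in> s" "Z \<in> A" for Y Z
    unfolding B_def mem_Collect_eq using that by iprover
  have BE: "\<exists>Y Z. P = Y \<inter> Z \<and> Y \<subseteq> states M \<and> m_box M Y \<in> s \<and> Z \<in> A" if "P \<in> B" for P
    using that unfolding B_def mem_Collect_eq .
  have "m_box M (states M) = states M"
    using kripke_accD[OF M] by (auto simp: m_box_def)
  then have top: "m_box M (states M) \<in> s"
    using ultrafilterD(2)[OF s] by simp
  obtain Z0 where Z0: "Z0 \<in> A" using A(2) by auto
  have "\<exists>t\<in>Uf (states M). B \<subseteq> t"
  proof (rule ultrafilter_extending_filter_base)
    show "B \<subseteq> Pow (states M)"
      using BE by (metis PowI le_infI1 subsetI)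
    show "B \<noteq> {}"
      using BI[OF order_refl top Z0] by auto
    show "{} \<notin> B"
    proof
      assume "{} \<in> B"
      then obtain Y Z where YZ: "{} = Y \<inter> Z" "Y \<subseteq> states M" "m_box M Y \<in> s" "Z \<in> A"
        using BE by metis
      then have "Y \<subseteq> states M - Z"
        using YZ(1)[symmetric] by (simp add: disjoint_iff subset_iff)
      then have "m_box M (states M - Z) \<in> s"
        using ultrafilterD(5)[OF s YZ(3) m_box_mono m_subset_states(3)] by simp
      then show False using possible[OF YZ(4)] by simp
    qed
    show "P \<inter> Q \<in> B" if "P \<in> B" "Q \<in> B" for P Q
    proof -
      obtain Y Z Y' Z' where *: "P = Y \<inter> Z" "Q = Y' \<inter> Z'" "Y \<subseteq> states M"
          "m_box M Y \<in> s" "m_box M Y' \<in> s" "Z \<in> A" "Z' \<in> A"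
        using BE[OF \<open>P \<in> B\<close>] BE[OF \<open>Q \<in> B\<close>] by metis
      have "m_box M (Y \<inter> Y') \<in> s"
        using ultrafilterD(4)[OF s *(4,5)] by (simp add: m_box_Int)
      then have "(Y \<inter> Y') \<inter> (Z \<inter> Z') \<in> B"
        using *(3) A(3)[OF *(6,7)] by (intro BI le_infI1)
      then show ?thesis
        by (simp add: *(1,2) Int_ac)
    qed
  qed
  then obtain t where t: "t \<in> Uf (states M)" "B \<subseteq> t" by auto
  have "Y \<in> t" if Y: "Y \<subseteq> states M" "m_box M Y \<in> s" for Y
    using ultrafilterD(5)[OF t(1) subsetD[OF t(2) BI[OF Y Z0]] Int_lower1 Y(1)] .
  then have "(s, t) \<in> acc (ue M)"
    using s t(1) X by (simp add: acc_ue_iff[OF M]) iprover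
  moreover have "Z \<in> t" if Z: "Z \<in> A" for Z
    using ultrafilterD(5)[OF t(1) subsetD[OF t(2) BI[OF order_refl top Z]] Int_lower2]
      subsetD[OF A(1) Z] by simp
  ultimately show ?thesis
    by (intro exI[of _ t] conjI subsetI)
qed

section \<open>The truth lemma\<close>

definition truth_set :: "('a, 'p) kripke \<Rightarrow> 'p fm \<Rightarrow> 'a set" where
  "truth_set M \<phi> = {s \<in> states M. sat M s \<phi>}"

lemma truth_set_subset: "truth_set M \<phi> \<subseteq> states M"
  by (auto simp: truth_set_def)

lemma truth_set_simps:
  assumes "kripke_model M"
  shows "truth_set M (Var p) = val M p"
    and "truth_set M (Neg \<phi>) = states M - truth_set M \<phi>"
    and "truth_set M (Conj \<phi> \<psi>) = truth_set M \<phi> \<inter> truth_set M \<psi>"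
    and "truth_set M (Nabla \<phi>) = m_nabla M (truth_set M \<phi>)"
proof -
  show "truth_set M (Var p) = val M p"
    using assms by (auto simp: truth_set_def kripke_model_def)
  show "truth_set M (Neg \<phi>) = states M - truth_set M \<phi>"
    and "truth_set M (Conj \<phi> \<psi>) = truth_set M \<phi> \<inter> truth_set M \<psi>"
    by (auto simp: truth_set_def)
  show "truth_set M (Nabla \<phi>) = m_nabla M (truth_set M \<phi>)"
    unfolding truth_set_def m_nabla_def sat.simps mem_Collect_eq
    using kripke_accD(2)[OF assms] by (intro Collect_cong) metis
qed

text \<open>
  The syntactic counterpart of \<open>necessity_definable_from_contingency\<close>, with the truth set of \<open>\<phi>\<close> in
  the role of \<open>X\<close> and the implication \<open>\<phi> \<longrightarrow> \<psi>\<close> written with negation and conjunction.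
\<close>

definition necessary_given_contingent :: "'p fm \<Rightarrow> 'p fm \<Rightarrow> 'p fm" where
  "necessary_given_contingent \<phi> \<psi> =
    Conj (Nabla \<phi>) (Conj (Delta \<psi>) (Delta (Neg (Conj \<phi> (Neg \<psi>)))))"

lemma truth_set_necessary_given_contingent:
  assumes "kripke_model M"
  shows "truth_set M (necessary_given_contingent \<phi> \<psi>) =
    m_nabla M (truth_set M \<phi>) \<inter> m_box M (truth_set M \<psi>)"
proof -
  have "states M - m_nabla M X = m_delta M X" for X
    unfolding m_nabla_def m_delta_def by blast
  moreover have "states M - (truth_set M \<phi> \<inter> (states M - truth_set M \<psi>)) =
      (states M - truth_set M \<phi>) \<union> truth_set M \<psi>"
    using truth_set_subset[of M \<psi>] by blast
  ultimately show ?thesis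
    by (simp add: necessary_given_contingent_def truth_set_simps[OF assms]
        necessity_definable_from_contingency[OF assms])
qed

lemma states_ue: "states (ue M) = Uf (states M)"
  by (simp add: ue_def)

lemma sat_ue_iff:
  assumes M: "kripke_model M" and "s \<in> Uf (states M)"
  shows "sat (ue M) s \<phi> \<longleftrightarrow> truth_set M \<phi> \<in> s"
  using assms(2)
proof (induction \<phi> arbitrary: s)
  case (Var p)
  then show ?case by (simp add: truth_set_simps[OF M]) (simp add: ue_def)
next
  case (Neg \<phi>)
  then show ?case
    by (simp add: truth_set_simps[OF M] ultrafilterD(6) truth_set_subset)
next
  case (Conj \<phi> \<psi>)
  then show ?case
    by (simp add: truth_set_simps[OF M] ultrafilter_Int_iff truth_set_subset)
next
  case (Nabla \<phi>)
  note s = \<open>s \<in> Uf (states M)\<close>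
  let ?X = "truth_set M \<phi>"
  have "sat (ue M) s (Nabla \<phi>) \<longleftrightarrow>
      (\<exists>t u. (s, t) \<in> acc (ue M) \<and> (s, u) \<in> acc (ue M) \<and> ?X \<in> t \<and> ?X \<notin> u)"
    using Nabla.IH acc_ueD(2)[OF M] unfolding sat.simps states_ue by metis
  also have "\<dots> \<longleftrightarrow> m_nabla M ?X \<in> s"
  proof
    assume "\<exists>t u. (s, t) \<in> acc (ue M) \<and> (s, u) \<in> acc (ue M) \<and> ?X \<in> t \<and> ?X \<notin> u"
    then obtain t u where tu: "(s, t) \<in> acc (ue M)" "(s, u) \<in> acc (ue M)" "?X \<in> t" "?X \<notin> u"
      by blast
    show "m_nabla M ?X \<in> s"
    proof (rule ccontr)
      assume "m_nabla M ?X \<notin> s"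
      then have "m_box M ?X \<union> m_box M (states M - ?X) \<in> s"
        using ultrafilterD(6)[OF s m_subset_states(1)] states_diff_m_nabla[OF M] by metis
      then have "m_box M ?X \<in> s \<or> m_box M (states M - ?X) \<in> s"
        by (rule ultrafilter_Un[OF s])
      then have "?X \<in> u \<or> states M - ?X \<in> t"
        using acc_ueD(3)[OF M tu(1) Diff_subset] acc_ueD(3)[OF M tu(2) truth_set_subset] by iprover
      then show False
        using tu(3,4) by (simp add: ultrafilterD(6)[OF acc_ueD(2)[OF M tu(1)]] truth_set_subset)
    qed
  next
    assume contingent: "m_nabla M ?X \<in> s"
    have disj: "m_nabla M ?X \<inter> m_box M ?X = {}" "m_nabla M ?X \<inter> m_box M (states M - ?X) = {}"
      using states_diff_m_nabla[OF M, of ?X] by blast+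
    have no_box: "m_box M ?X \<notin> s" "m_box M (states M - ?X) \<notin> s"
      using ultrafilterD(3,4)[OF s] contingent disj by metis+
    have "\<exists>t. (s, t) \<in> acc (ue M) \<and> {?X} \<subseteq> t"
      using no_box by (intro ue_saturated[OF M s truth_set_subset contingent]) (auto simp: truth_set_subset)
    moreover have "\<exists>u. (s, u) \<in> acc (ue M) \<and> {states M - ?X} \<subseteq> u"
      using no_box by (intro ue_saturated[OF M s truth_set_subset contingent])
        (auto simp: double_diff[OF truth_set_subset])
    ultimately obtain t u where tu: "(s, t) \<in> acc (ue M)" "?X \<in> t"
        "(s, u) \<in> acc (ue M)" "states M - ?X \<in> u"
      by auto
    then have "?X \<notin> u"
      by (simp add: ultrafilterD(6)[OF acc_ueD(2)[OF M tu(3)]] truth_set_subset)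
    with tu show "\<exists>t u. (s, t) \<in> acc (ue M) \<and> (s, u) \<in> acc (ue M) \<and> ?X \<in> t \<and> ?X \<notin> u"
      by iprover
  qed
  finally show ?case by (simp add: truth_set_simps[OF M])
qed

lemma sat_ue_principal:
  assumes "kripke_model M" and "w \<in> states M"
  shows "sat (ue M) (principal_ultrafilter (states M) w) \<phi> \<longleftrightarrow> sat M w \<phi>"
  unfolding sat_ue_iff[OF assms(1) principal_ultrafilter_in_Uf[OF assms(2)]]
  using assms(2) by (auto simp: principal_ultrafilter_def truth_set_def)

section \<open>Equivalence and \<Delta>-bisimilarity of ultrafilter extensions\<close>

text \<open>
  The two inequivalent successors provide a formula \<open>\<phi>\<close> that is contingent at \<^term>\<open>s\<close>, hence at
  \<^term>\<open>s'\<close>. With it the necessity of \<open>\<not> \<psi>\<close> is expressed at both states by the same formula, so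
  whatever holds at the successor \<^term>\<open>t\<close> is possible according to \<^term>\<open>s'\<close>, and saturation
  applies to the theory of \<^term>\<open>t\<close>.
\<close>

lemma ue_forth:
  assumes M: "kripke_model M" and M': "kripke_model M'"
    and s': "s' \<in> Uf (states M')"
    and eq: "nabla_equiv (ue M) s (ue M') s'"
    and branch: "(s, t1) \<in> acc (ue M)" "(s, t2) \<in> acc (ue M)" "\<not> nabla_equiv (ue M) t1 (ue M) t2"
    and t: "(s, t) \<in> acc (ue M)"
  shows "\<exists>t'. (s', t') \<in> acc (ue M') \<and> nabla_equiv (ue M) t (ue M') t'"
proof -
  have s: "s \<in> Uf (states M)" and t_uf: "t \<in> Uf (states M)"
    using acc_ueD(1,2)[OF M t] by simp_all
  have transfer: "truth_set M \<theta> \<in> s \<longleftrightarrow> truth_set M' \<theta> \<in> s'" for \<theta>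
    using eq by (simp add: nabla_equiv_def sat_ue_iff[OF M s] sat_ue_iff[OF M' s'])
  obtain \<phi> where "sat (ue M) t1 \<phi> \<noteq> sat (ue M) t2 \<phi>"
    using branch(3) by (auto simp: nabla_equiv_def)
  then have "sat (ue M) s (Nabla \<phi>)"
    using branch(1,2) acc_ueD(2)[OF M] unfolding sat.simps states_ue by metis
  then have phi: "truth_set M (Nabla \<phi>) \<in> s" "truth_set M' (Nabla \<phi>) \<in> s'"
    unfolding transfer[symmetric] sat_ue_iff[OF M s] by simp_all
  let ?A = "{truth_set M' \<psi> | \<psi>. truth_set M \<psi> \<in> t}"
  have "\<exists>t'. (s', t') \<in> acc (ue M') \<and> ?A \<subseteq> t'"
  proof (rule ue_saturated[OF M' s'])
    show "truth_set M' \<phi> \<subseteq> states M'" "m_nabla M' (truth_set M' \<phi>) \<in> s'"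
      using phi(2) by (simp_all add: truth_set_subset truth_set_simps(4)[OF M'])
    show "?A \<subseteq> Pow (states M')"
      using truth_set_subset by fastforce
    have "truth_set M \<phi> \<in> t \<or> truth_set M (Neg \<phi>) \<in> t"
      by (simp add: truth_set_simps[OF M] ultrafilterD(6)[OF t_uf] truth_set_subset)
    then show "?A \<noteq> {}" by auto
    show "Y \<inter> Z \<in> ?A" if "Y \<in> ?A" "Z \<in> ?A" for Y Z
    proof -
      obtain \<psi> \<chi> where "Y = truth_set M' \<psi>" "Z = truth_set M' \<chi>"
          "truth_set M \<psi> \<in> t" "truth_set M \<chi> \<in> t"
        using \<open>Y \<in> ?A\<close> \<open>Z \<in> ?A\<close> by auto
      then have "Y \<inter> Z = truth_set M' (Conj \<psi> \<chi>)" "truth_set M (Conj \<psi> \<chi>) \<in> t"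
        using ultrafilterD(4)[OF t_uf] by (simp_all add: truth_set_simps[OF M] truth_set_simps[OF M'])
      then show ?thesis by (intro CollectI exI conjI)
    qed
    show "m_box M' (states M' - Z) \<notin> s'" if "Z \<in> ?A" for Z
    proof
      assume box: "m_box M' (states M' - Z) \<in> s'"
      obtain \<psi> where psi: "Z = truth_set M' \<psi>" "truth_set M \<psi> \<in> t"
        using \<open>Z \<in> ?A\<close> by auto
      have "truth_set M' (necessary_given_contingent \<phi> (Neg \<psi>)) \<in> s'"
        using box phi(2) psi(1) ultrafilterD(4)[OF s']
        by (simp add: truth_set_necessary_given_contingent[OF M'] truth_set_simps[OF M'])
      then have "truth_set M (necessary_given_contingent \<phi> (Neg \<psi>)) \<in> s"
        by (simp add: transfer)
      then have "m_box M (truth_set M (Neg \<psi>)) \<in> s"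
        by (simp add: truth_set_necessary_given_contingent[OF M] ultrafilter_Int_iff[OF s] m_subset_states)
      then have "truth_set M (Neg \<psi>) \<in> t"
        by (rule acc_ueD(3)[OF M t truth_set_subset])
      then show False
        using psi(2) by (simp add: truth_set_simps[OF M] ultrafilterD(6)[OF t_uf] truth_set_subset)
    qed
  qed
  then obtain t' where t': "(s', t') \<in> acc (ue M')" "?A \<subseteq> t'" by blast
  have t'_uf: "t' \<in> Uf (states M')"
    using acc_ueD(2)[OF M' t'(1)] .
  \<comment> \<open>The theory of \<open>t\<close> is included in that of \<open>t'\<close>; the two coincide because each contains
    exactly one of a formula and its negation.\<close>
  have "truth_set M \<psi> \<in> t \<longleftrightarrow> truth_set M' \<psi> \<in> t'" for \<psi>
  proof
    assume "truth_set M \<psi> \<in> t"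
    then show "truth_set M' \<psi> \<in> t'" using t'(2) by auto
  next
    assume in': "truth_set M' \<psi> \<in> t'"
    show "truth_set M \<psi> \<in> t"
    proof (rule ccontr)
      assume "truth_set M \<psi> \<notin> t"
      then have "truth_set M (Neg \<psi>) \<in> t"
        by (simp add: truth_set_simps[OF M] ultrafilterD(6)[OF t_uf] truth_set_subset)
      then have "truth_set M' (Neg \<psi>) \<in> t'" using t'(2) by auto
      then show False
        using in' by (simp add: truth_set_simps[OF M'] ultrafilterD(6)[OF t'_uf] truth_set_subset)
    qed
  qed
  then have "nabla_equiv (ue M) t (ue M') t'"
    by (simp add: nabla_equiv_def sat_ue_iff[OF M t_uf] sat_ue_iff[OF M' t'_uf])
  with t'(1) show ?thesis by blast
qed

lemma sat_disjoint_union: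
  "sat (disjoint_union M M') (Inl s) \<phi> \<longleftrightarrow> sat M s \<phi>"
  "sat (disjoint_union M M') (Inr s') \<phi> \<longleftrightarrow> sat M' s' \<phi>"
  by (induction \<phi> arbitrary: s s') (auto simp: disjoint_union_def Plus_def Bex_def)

lemma nabla_equiv_disjoint_union:
  "nabla_equiv (disjoint_union M M') (Inl s) (disjoint_union M M') (Inl t) \<longleftrightarrow> nabla_equiv M s M t"
  "nabla_equiv (disjoint_union M M') (Inl s) (disjoint_union M M') (Inr t') \<longleftrightarrow> nabla_equiv M s M' t'"
  "nabla_equiv (disjoint_union M M') (Inr s') (disjoint_union M M') (Inl t) \<longleftrightarrow> nabla_equiv M' s' M t"
  "nabla_equiv (disjoint_union M M') (Inr s') (disjoint_union M M') (Inr t') \<longleftrightarrow> nabla_equiv M' s' M' t'"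
  by (simp_all add: nabla_equiv_def sat_disjoint_union)

lemma disjoint_union_simps:
  "Inl s \<in> states (disjoint_union M M') \<longleftrightarrow> s \<in> states M"
  "Inr s' \<in> states (disjoint_union M M') \<longleftrightarrow> s' \<in> states M'"
  "(Inl s, y) \<in> acc (disjoint_union M M') \<longleftrightarrow> (\<exists>t. y = Inl t \<and> (s, t) \<in> acc M)"
  "(Inr s', y) \<in> acc (disjoint_union M M') \<longleftrightarrow> (\<exists>t'. y = Inr t' \<and> (s', t') \<in> acc M')"
  by (auto simp: disjoint_union_def)

lemma kripke_model_disjoint_union:
  assumes "kripke_model M" and "kripke_model M'"
  shows "kripke_model (disjoint_union M M')"
  using assms unfolding kripke_model_def disjoint_union_def by fastforce

lemma delta_bisimulation_sat:
  assumes N: "kripke_model N" and "delta_bisimulation N Z" and "(s, s') \<in> Z"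
  shows "sat N s \<phi> \<longleftrightarrow> sat N s' \<phi>"
  using assms(3)
proof (induction \<phi> arbitrary: s s')
  case (Var p)
  then show ?case using assms(2) by (auto simp: delta_bisimulation_def)
next
  case (Nabla \<phi>)
  \<comment> \<open>Successors that disagree on \<open>\<phi>\<close> are unrelated by the induction hypothesis, and so unlock the
    transfer of successors.\<close>
  have zig: "\<exists>t'. (s', t') \<in> acc N \<and> (x, t') \<in> Z"
    if "(s, t) \<in> acc N" "(s, u) \<in> acc N" "sat N t \<phi>" "\<not> sat N u \<phi>" "(s, x) \<in> acc N" for t u x
  proof -
    have "t \<noteq> u" "(t, u) \<notin> Z" using that Nabla.IH by blast+
    then show ?thesis
      using assms(2) Nabla.prems that unfolding delta_bisimulation_def by blast
  qed
  have zag: "\<exists>t. (s, t) \<in> acc N \<and> (t, x) \<in> Z"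
    if "(s', t) \<in> acc N" "(s', u) \<in> acc N" "sat N t \<phi>" "\<not> sat N u \<phi>" "(s', x) \<in> acc N" for t u x
  proof -
    have "t \<noteq> u" "(t, u) \<notin> Z" using that Nabla.IH by blast+
    then show ?thesis
      using assms(2) Nabla.prems that unfolding delta_bisimulation_def by blast
  qed
  show ?case
    unfolding sat.simps
  proof
    assume "\<exists>t\<in>states N. \<exists>u\<in>states N. (s, t) \<in> acc N \<and> (s, u) \<in> acc N \<and> sat N t \<phi> \<and> \<not> sat N u \<phi>"
    then obtain t u where tu: "(s, t) \<in> acc N" "(s, u) \<in> acc N" "sat N t \<phi>" "\<not> sat N u \<phi>"
      by blast
    obtain t' u' where "(s', t') \<in> acc N" "(t, t') \<in> Z" "(s', u') \<in> acc N" "(u, u') \<in> Z"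
      using zig[OF tu tu(1)] zig[OF tu tu(2)] by blast
    then show "\<exists>t\<in>states N. \<exists>u\<in>states N.
        (s', t) \<in> acc N \<and> (s', u) \<in> acc N \<and> sat N t \<phi> \<and> \<not> sat N u \<phi>"
      using Nabla.IH tu(3,4) kripke_accD(2)[OF N] by blast
  next
    assume "\<exists>t\<in>states N. \<exists>u\<in>states N. (s', t) \<in> acc N \<and> (s', u) \<in> acc N \<and> sat N t \<phi> \<and> \<not> sat N u \<phi>"
    then obtain t u where tu: "(s', t) \<in> acc N" "(s', u) \<in> acc N" "sat N t \<phi>" "\<not> sat N u \<phi>"
      by blast
    obtain t' u' where "(s, t') \<in> acc N" "(t', t) \<in> Z" "(s, u') \<in> acc N" "(u', u) \<in> Z"
      using zag[OF tu tu(1)] zag[OF tu tu(2)] by blast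
    then show "\<exists>t\<in>states N. \<exists>u\<in>states N.
        (s, t) \<in> acc N \<and> (s, u) \<in> acc N \<and> sat N t \<phi> \<and> \<not> sat N u \<phi>"
      using Nabla.IH tu(3,4) kripke_accD(2)[OF N] by blast
  qed
qed auto

lemma delta_bisimilar_imp_nabla_equiv:
  assumes "kripke_model N" "kripke_model N'" and "delta_bisimilar N s N' s'"
  shows "nabla_equiv N s N' s'"
proof -
  obtain Z where "delta_bisimulation (disjoint_union N N') Z" "(Inl s, Inr s') \<in> Z"
    using assms(3) by (auto simp: delta_bisimilar_def)
  from delta_bisimulation_sat[OF kripke_model_disjoint_union[OF assms(1,2)] this]
  show ?thesis by (simp add: nabla_equiv_def sat_disjoint_union)
qed

text \<open>
  Related points may lie in the same component of the disjoint union, so the zig condition is needed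
  for all four pairings of components; each is an instance of \<open>ue_forth\<close>. The zag condition is the
  zig condition again, as equivalence is symmetric.
\<close>

lemma nabla_equiv_ue_imp_delta_bisimilar:
  assumes M: "kripke_model M" and M': "kripke_model M'"
    and s: "s \<in> Uf (states M)" and s': "s' \<in> Uf (states M')"
    and eq: "nabla_equiv (ue M) s (ue M') s'"
  shows "delta_bisimilar (ue M) s (ue M') s'"
proof -
  let ?D = "disjoint_union (ue M) (ue M')"
  define Z where
    "Z = {(x, y). x \<in> states ?D \<and> y \<in> states ?D \<and> nabla_equiv ?D x ?D y}"
  have sym: "(y, x) \<in> Z" if "(x, y) \<in> Z" for x y
    using that by (auto simp: Z_def nabla_equiv_def)
  have D: "kripke_model ?D"
    using M M' by (intro kripke_model_disjoint_union kripke_model_ue)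
  have forth: "\<exists>z'. (y, z') \<in> acc ?D \<and> (z, z') \<in> Z"
    if xy: "(x, y) \<in> Z" and br: "(x, z1) \<in> acc ?D" "(x, z2) \<in> acc ?D" "(z1, z2) \<notin> Z"
      and z: "(x, z) \<in> acc ?D" for x y z z1 z2
  proof -
    have "\<exists>z'. (y, z') \<in> acc ?D \<and> nabla_equiv ?D z ?D z'"
    proof -
      have neq: "\<not> nabla_equiv ?D z1 ?D z2"
        using br kripke_accD(2)[OF D] by (auto simp: Z_def)
      have y: "y \<in> states ?D" and xy': "nabla_equiv ?D x ?D y"
        using xy by (auto simp: Z_def)
      note simps = disjoint_union_simps nabla_equiv_disjoint_union states_ue
      show ?thesis
      proof (cases x; cases y)
        fix a b assume eqs: "x = Inl a" "y = Inl b"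
        obtain c c1 c2 where c: "z = Inl c" "z1 = Inl c1" "z2 = Inl c2"
            "(a, c) \<in> acc (ue M)" "(a, c1) \<in> acc (ue M)" "(a, c2) \<in> acc (ue M)"
          using br(1,2) z by (auto simp: eqs disjoint_union_simps)
        have "\<exists>c'. (b, c') \<in> acc (ue M) \<and> nabla_equiv (ue M) c (ue M) c'"
          using y xy' neq c
          by (intro ue_forth[OF M M, of b a c1 c2]) (simp_all add: simps eqs)
        then show ?thesis
          by (auto simp: c eqs simps)
      next
        fix a b assume eqs: "x = Inl a" "y = Inr b"
        obtain c c1 c2 where c: "z = Inl c" "z1 = Inl c1" "z2 = Inl c2"
            "(a, c) \<in> acc (ue M)" "(a, c1) \<in> acc (ue M)" "(a, c2) \<in> acc (ue M)"
          using br(1,2) z by (auto simp: eqs disjoint_union_simps)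
        have "\<exists>c'. (b, c') \<in> acc (ue M') \<and> nabla_equiv (ue M) c (ue M') c'"
          using y xy' neq c
          by (intro ue_forth[OF M M', of b a c1 c2]) (simp_all add: simps eqs)
        then show ?thesis
          by (auto simp: c eqs simps)
      next
        fix a b assume eqs: "x = Inr a" "y = Inl b"
        obtain c c1 c2 where c: "z = Inr c" "z1 = Inr c1" "z2 = Inr c2"
            "(a, c) \<in> acc (ue M')" "(a, c1) \<in> acc (ue M')" "(a, c2) \<in> acc (ue M')"
          using br(1,2) z by (auto simp: eqs disjoint_union_simps)
        have "\<exists>c'. (b, c') \<in> acc (ue M) \<and> nabla_equiv (ue M') c (ue M) c'"
          using y xy' neq c
          by (intro ue_forth[OF M' M, of b a c1 c2]) (simp_all add: simps eqs)
        then show ?thesis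
          by (auto simp: c eqs simps)
      next
        fix a b assume eqs: "x = Inr a" "y = Inr b"
        obtain c c1 c2 where c: "z = Inr c" "z1 = Inr c1" "z2 = Inr c2"
            "(a, c) \<in> acc (ue M')" "(a, c1) \<in> acc (ue M')" "(a, c2) \<in> acc (ue M')"
          using br(1,2) z by (auto simp: eqs disjoint_union_simps)
        have "\<exists>c'. (b, c') \<in> acc (ue M') \<and> nabla_equiv (ue M') c (ue M') c'"
          using y xy' neq c
          by (intro ue_forth[OF M' M', of b a c1 c2]) (simp_all add: simps eqs)
        then show ?thesis
          by (auto simp: c eqs simps)
      qed
    qed
    then show ?thesis
      using kripke_accD(2)[OF D] z unfolding Z_def by blast
  qed
  have vars: "x \<in> val ?D p \<longleftrightarrow> y \<in> val ?D p" if "(x, y) \<in> Z" for x y p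
    using that unfolding Z_def nabla_equiv_def by (auto dest: spec[where x = "Var p"])
  have mem: "(Inl s, Inr s') \<in> Z"
    using s s' eq by (simp add: Z_def disjoint_union_simps states_ue nabla_equiv_disjoint_union)
  have "delta_bisimulation ?D Z"
    unfolding delta_bisimulation_def
  proof (intro conjI ballI)
    show "Z \<noteq> {}" "Z \<subseteq> states ?D \<times> states ?D"
      using mem by (auto simp: Z_def)
  next
    fix q assume "q \<in> Z"
    then obtain x y where q: "q = (x, y)" "(x, y) \<in> Z" by (cases q) auto
    have zag: "\<exists>z. (x, z) \<in> acc ?D \<and> (z, z') \<in> Z"
      if "(y, z1) \<in> acc ?D" "(y, z2) \<in> acc ?D" "(z1, z2) \<notin> Z" "(y, z') \<in> acc ?D" for z1 z2 z'
      using forth[OF sym[OF q(2)] that] sym by blast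
    show "case q of (x, y) \<Rightarrow>
        (\<forall>p. x \<in> val ?D p \<longleftrightarrow> y \<in> val ?D p) \<and>
        ((\<exists>t1 t2. t1 \<noteq> t2 \<and> (x, t1) \<in> acc ?D \<and> (x, t2) \<in> acc ?D \<and> (t1, t2) \<notin> Z) \<longrightarrow>
           (\<forall>t. (x, t) \<in> acc ?D \<longrightarrow> (\<exists>t'. (y, t') \<in> acc ?D \<and> (t, t') \<in> Z))) \<and>
        ((\<exists>t1' t2'. t1' \<noteq> t2' \<and> (y, t1') \<in> acc ?D \<and> (y, t2') \<in> acc ?D \<and> (t1', t2') \<notin> Z) \<longrightarrow>
           (\<forall>t'. (y, t') \<in> acc ?D \<longrightarrow> (\<exists>t. (x, t) \<in> acc ?D \<and> (t, t') \<in> Z)))"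
      unfolding q(1) prod.case
      using vars[OF q(2)] forth[OF q(2)] zag by blast
  qed
  with mem show ?thesis
    unfolding delta_bisimilar_def by blast
qed

theorem theorem19:
  fixes M :: "('a, 'p) kripke" and M' :: "('b, 'p) kripke"
    and w :: 'a and w' :: 'b
  assumes "kripke_model M" and "kripke_model M'"
    and "w \<in> states M" and "w' \<in> states M'"
  shows "nabla_equiv M w M' w' \<longleftrightarrow>
    delta_bisimilar (ue M) (principal_ultrafilter (states M) w) (ue M') (principal_ultrafilter (states M') w')"
proof -
  let ?p = "principal_ultrafilter (states M) w" and ?p' = "principal_ultrafilter (states M') w'"
  have "nabla_equiv M w M' w' \<longleftrightarrow> nabla_equiv (ue M) ?p (ue M') ?p'"
    using assms by (simp add: nabla_equiv_def sat_ue_principal)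
  also have "\<dots> \<longleftrightarrow> delta_bisimilar (ue M) ?p (ue M') ?p'"
    using nabla_equiv_ue_imp_delta_bisimilar[OF assms(1,2)]
      delta_bisimilar_imp_nabla_equiv[OF assms(1,2)[THEN kripke_model_ue]]
      principal_ultrafilter_in_Uf[OF assms(3)] principal_ultrafilter_in_Uf[OF assms(4)]
    by blast
  finally show ?thesis .
qed

end
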